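(* Let $m$ and $n$ be two natural numbers of the same parity with $m\ge n\ge 2$. Then $$\int_{0}^{\infty}\frac{\tanh^m(z)}{z^n}\,dz =\binom{m+\lfloor \frac{m}{2}\rfloor}{m} \sum_{\substack{1\le j\le m\\ j\equiv m \ (\mathrm{mod}\ 2)}} \binom{-n}{j-1}\,\frac{2^{n+j-1}-1}{(\pi i)^{n+j-2}}\,\zeta(n+j-1)\; S_{m,j},$$ where $$S_{m,j}=\sum_{\lambda=0}^{m}\ \sum_{\mu=0}^{\lfloor \frac{m}{2}\rfloor}\ \sum_{\nu=0}^{\mu} (-1)^{\mu+\nu}\,\frac{m}{m+\mu} \binom{m}{\lambda}\binom{\lfloor \frac{m}{2}\rfloor}{\mu}\binom{\mu}{\nu}\, \frac{(m-2\lambda+\mu-2\nu)^{m+\mu-j}}{2^{m+\mu}\,(m+\mu-j)!}.$$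
   Context: Here $\zeta$ is the Riemann zeta function, $i$ is the imaginary unit, $\lfloor x\rfloor$ is the greatest integer not exceeding $x$, and $\binom{-n}{j-1}$ is the generalized binomial coefficient, $\binom{a}{k}=\frac{a(a-1)\cdots(a-k+1)}{k!}$ for an integer $k\ge 0$ (equal to $1$ if $k=0$). The convention $0^0=1$ is used. *)

theory Defs
  imports "HOL-Analysis.Analysis"
begin

text \<open>
  The Riemann zeta function in its half-plane of absolute convergence
  \<open>Re s > 1\<close>, by its Dirichlet series; the value is unspecified where the series
  diverges.
\<close>

definition zeta :: "complex \<Rightarrow> complex" where
  "zeta s = (\<Sum>k. 1 / of_nat (Suc k) powr s)"

text \<open>
  The base of the power in the last factor is an integer, possibly negative or zero;
  \<open>0 ^ 0 = 1\<close> for \<open>(^)\<close>. For \<open>j \<le> m\<close>, the only case of interest, the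
  subtraction \<open>m + u - j\<close> on naturals is not truncated.
\<close>

definition S :: "nat \<Rightarrow> nat \<Rightarrow> real" where
  "S m j =
    (\<Sum>l=0..m. \<Sum>u=0..m div 2. \<Sum>v=0..u.
       (-1) ^ (u + v) * (real m / real (m + u))
       * real (m choose l) * real ((m div 2) choose u) * real (u choose v)
       * (real_of_int (int m - 2 * int l + int u - 2 * int v) ^ (m + u - j)
          / (2 ^ (m + u) * fact (m + u - j))))"

end

theory Submission
  imports Defs "HOL-Complex_Analysis.Complex_Analysis"
begin

text \<open>
  The integrand is even, so the integral is half of the integral over the real line, which is
  computed by residues in the rectangles with corners \<open>-N\<close> and \<open>N + i \<pi> N\<close>: on the three
  sides off the real axis \<open>tanh\<close> is bounded by 2, so they contribute \<open>O(1/N)\<close>. At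
  \<open>z\<^sub>k = i \<pi> (k + 1/2)\<close> we have \<open>tanh (z\<^sub>k + w) = coth w\<close>, so the residue is
  \<open>\<Sum>j. c\<^sub>j (-n gchoose (j - 1)) / z\<^sub>k ^ (n + j - 1)\<close>, where \<open>c\<^sub>j\<close> is the coefficient of
  \<open>w ^ (m - j)\<close> in \<open>(w coth w) ^ m\<close>; the sums over \<open>k\<close> are zeta values.

  For the closed form of \<open>c\<^sub>j\<close>, put \<open>F = sinh w / w\<close>. Expanding \<open>F\<close> to the power \<open>-m\<close>
  in powers of \<open>1 - F = O(w ^ 2)\<close>, truncating at order \<open>m div 2\<close> and reordering by powers of \<open>F\<close>
  leaves the products \<open>cosh w ^ m * sinh w ^ u\<close>, which are sums of exponentials.
\<close>

unbundle no vec_syntax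

section \<open>Laurent coefficients of powers of coth\<close>

definition fps_cosh :: "complex fps" where
  "fps_cosh = fps_const (1/2) * (fps_exp 1 + fps_exp (-1))"

text \<open>The shift is an exact division by \<open>fps_X\<close>, because the constant terms of
  the two exponentials cancel. The constant coefficient left over is 1, so the series is
  invertible.\<close>

definition fps_sinhc :: "complex fps" where
  "fps_sinhc = fps_shift 1 (fps_const (1/2) * (fps_exp 1 - fps_exp (-1)))"

text \<open>The power series of \<open>(w coth w)\<close> to the power \<open>m\<close>.\<close>

definition fps_coth_pow :: "nat \<Rightarrow> complex fps" where
  "fps_coth_pow m = fps_cosh ^ m * inverse fps_sinhc ^ m"

lemma fps_X_sinhc: "fps_X * fps_sinhc = fps_const (1/2) * (fps_exp 1 - fps_exp (-1))"
  by (rule fps_ext) (simp add: fps_sinhc_def)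

lemma fps_sinhc_nth_0 [simp]: "fps_sinhc $ 0 = 1"
  by (simp add: fps_sinhc_def)

lemma fps_sinhc_nth_1 [simp]: "fps_sinhc $ Suc 0 = 0"
  by (simp add: fps_sinhc_def)

text \<open>Such a \<open>u\<close> is divisible by \<open>fps_X ^ 2\<close>, hence
  \<open>u ^ i\<close> by \<open>fps_X ^ (2 * i)\<close>.\<close>

lemma fps_nth_power_eq_0:
  fixes u :: "'a::comm_ring_1 fps"
  assumes "u $ 0 = 0" "u $ 1 = 0" "n < 2 * i"
  shows "(u ^ i) $ n = 0"
proof -
  have "u = fps_X ^ 2 * fps_shift 2 u"
    using assms(1,2)
    by (intro fps_ext) (metis One_nat_def fps_X_power_mult_nth fps_shift_nth le_add_diff_inverse2 less_2_cases not_less)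
  then have "u ^ i = fps_X ^ (2 * i) * fps_shift 2 u ^ i"
    by (metis power_mult power_mult_distrib)
  then show ?thesis
    using assms(3) by (simp add: fps_X_power_mult_nth)
qed

text \<open>Since \<open>1 - F\<close> has order at least 2, the binomial series of
  \<open>(1 - (1 - F))\<close> to the power \<open>-m\<close> may be cut off after its \<open>M\<close>-th term.\<close>

lemma inverse_power_truncation:
  fixes F :: "'a::field_char_0 fps"
  assumes F: "F $ 0 = 1" "F $ 1 = 0" and m: "m > 0" and n: "n \<le> 2 * M + 1"
  shows "(inverse F ^ m) $ n = (\<Sum>i\<le>M. of_nat ((m + i - 1) choose i) * (1 - F) ^ i) $ n"
proof -
  define u where "u = 1 - F"
  have u0: "u $ 0 = 0" "u $ 1 = 0" using F by (simp_all add: u_def)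
  let ?a = "inverse ((1 - fps_X) ^ m) :: 'a fps"
  have a: "?a = Abs_fps (\<lambda>k. of_nat ((m + k - 1) choose k))"
    using one_minus_const_fps_X_neg_power'[OF m, of "1::'a"] by simp
  \<comment> \<open>Substituting \<open>u\<close> for the variable carries the known series of the
    negative power of \<open>1 - fps_X\<close> over to \<open>F\<close>.\<close>
  have "(1 - fps_X) oo u = F"
    using u0 by (simp add: fps_compose_sub_distrib u_def)
  then have "inverse F ^ m = inverse (((1 - fps_X) oo u) ^ m)"
    by (simp add: fps_inverse_power)
  also have "\<dots> = inverse ((1 - fps_X) ^ m oo u)"
    using fps_compose_power[OF u0(1), of "1 - fps_X"] by simp
  also have "\<dots> = ?a oo u"
    using u0(1) by (subst fps_inverse_compose) (simp_all add: fps_power_zeroth)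
  finally have "(inverse F ^ m) $ n = (\<Sum>i=0..n. of_nat ((m + i - 1) choose i) * (u ^ i) $ n)"
    by (simp add: fps_compose_nth a)
  \<comment> \<open>The ranges up to \<open>n\<close> and up to \<open>M\<close> are compared inside
    a common larger one. Terms with \<open>i > n\<close> vanish because \<open>n < 2 * i\<close>,
    and those with \<open>i > M\<close> because \<open>n <= 2 * M + 1 < 2 * i\<close>.\<close>
  also have "\<dots> = (\<Sum>i\<le>n + M. of_nat ((m + i - 1) choose i) * (u ^ i) $ n)"
    by (rule sum.mono_neutral_left) (auto intro!: fps_nth_power_eq_0 u0)
  also have "\<dots> = (\<Sum>i\<le>M. of_nat ((m + i - 1) choose i) * (u ^ i) $ n)"
    by (rule sum.mono_neutral_right) (use n in \<open>auto intro!: fps_nth_power_eq_0 u0\<close>)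
  also have "\<dots> = (\<Sum>i\<le>M. of_nat ((m + i - 1) choose i) * u ^ i) $ n"
    by (simp add: fps_sum_nth fps_mult_left_const_nth flip: fps_of_nat)
  finally show ?thesis by (simp add: u_def)
qed

text \<open>Up to the sign \<open>(-1) ^ u\<close>, this is the coefficient of \<open>F ^ u\<close>
  once every \<open>(1 - F) ^ i\<close> in the truncated series is expanded. It is the source of the
  outer binomial coefficient of the theorem and of the factor \<open>m / (m + u)\<close> in
  \<open>S\<close>.\<close>

lemma sum_choose_mult_choose:
  assumes "m > 0"
  shows "(\<Sum>i\<le>M. real ((m + i - 1) choose i) * real (i choose u))
    = real ((m + M) choose m) * (real m / real (m + u)) * real (M choose u)"
proof (induction M)
  case 0
  show ?case using assms by (cases u) auto
next
  case (Suc M)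
  show ?case
  proof (cases "u \<le> Suc M")
    case False
    then show ?thesis using Suc by (simp add: binomial_eq_0 del: binomial_Suc_Suc)
  next
    case True
    have a: "real (Suc M) * real ((m + Suc M) choose m) = real (m + Suc M) * real ((m + M) choose m)"
      using arg_cong[OF Suc_times_binomial_eq[of "m + M" M], of real]
        binomial_symmetric[of m "m + M"] binomial_symmetric[of m "m + Suc M"]
      by (simp add: algebra_simps del: binomial_Suc_Suc)
    have b: "real (Suc M) * real ((m + M) choose Suc M) = real m * real ((m + M) choose m)"
    proof -
      have "Suc M * ((m + M) choose Suc M) = m * ((m + M) choose m)"
        using binomial_absorption[of M "m + M"] binomial_absorb_comp[of "m + M" M]
          binomial_symmetric[of m "m + M"]
        by simp
      then show ?thesis
        by (simp only: flip: of_nat_mult)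
    qed
    have c: "real (Suc M) * real (M choose u) = real (Suc M - u) * real (Suc M choose u)"
      using binomial_absorb_comp[of "Suc M" u] by (simp only: diff_Suc_1 flip: of_nat_mult)
    \<comment> \<open>With \<open>a\<close>, \<open>b\<close> and \<open>c\<close>, every binomial
      coefficient of the induction step becomes a rational multiple of \<open>p\<close> or
      \<open>q\<close>. What remains is a rational identity resting on
      \<open>(y + m - x) + x = y + m\<close>.\<close>
    define p q where "p = real ((m + M) choose m)" and "q = real (Suc M choose u)"
    have a': "real ((m + Suc M) choose m) = real (m + Suc M) * p / real (Suc M)"
      using a by (simp add: p_def field_simps del: of_nat_Suc of_nat_add)
    have b': "real ((m + M) choose Suc M) = real m * p / real (Suc M)"
      using b by (simp add: p_def field_simps del: of_nat_Suc of_nat_add)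
    have c': "real (M choose u) = real (Suc M - u) * q / real (Suc M)"
      using c by (simp add: q_def field_simps del: of_nat_Suc of_nat_add binomial_Suc_Suc)
    have "(\<Sum>i\<le>Suc M. real ((m + i - 1) choose i) * real (i choose u))
      = p * (real m / real (m + u)) * real (M choose u) + real ((m + M) choose Suc M) * q"
      using Suc.IH by (simp add: p_def q_def)
    also have "\<dots> = real ((m + Suc M) choose m) * (real m / real (m + u)) * q"
    proof -
      define x y where "x = real (m + u)" and "y = real (Suc M)"
      have "x > 0" "y > 0" using assms by (simp_all add: x_def y_def)
      then have "p * (real m / x) * ((y + real m - x) * q / y) + real m * p / y * q =
          (real m + y) * p / y * (real m / x) * q"
        by (simp add: field_simps)
      moreover have "real (Suc M - u) = y + real m - x" "real (m + Suc M) = real m + y"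
        using True by (simp_all add: x_def y_def of_nat_diff)
      ultimately show ?thesis
        unfolding a' b' c' by (simp only: x_def y_def)
    qed
    finally show ?thesis by (simp only: q_def)
  qed
qed


section \<open>Products of hyperbolic functions as sums of exponentials\<close>

lemma fps_cosh_power:
  "fps_cosh ^ m = fps_const (1 / 2 ^ m) *
     (\<Sum>l\<le>m. fps_const (of_nat (m choose l)) * fps_exp (of_int (int m - 2 * int l)))"
proof -
  have "(fps_exp (-1) + fps_exp 1 :: complex fps) ^ m =
      (\<Sum>l\<le>m. of_nat (m choose l) * fps_exp (-1) ^ l * fps_exp 1 ^ (m - l))"
    by (rule binomial_ring)
  also have "\<dots> = (\<Sum>l\<le>m. fps_const (of_nat (m choose l)) * fps_exp (of_int (int m - 2 * int l)))"
    by (intro sum.cong refl)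
       (simp add: fps_exp_power_mult fps_of_nat of_nat_diff mult.assoc algebra_simps flip: fps_exp_add_mult)
  finally show ?thesis
    by (simp add: fps_cosh_def power_mult_distrib fps_const_power power_divide add.commute)
qed

lemma fps_X_sinhc_power:
  "(fps_X * fps_sinhc) ^ u = fps_const (1 / 2 ^ u) *
     (\<Sum>v\<le>u. fps_const ((-1) ^ v * of_nat (u choose v)) * fps_exp (of_int (int u - 2 * int v)))"
proof -
  have "(- fps_exp (-1) + fps_exp 1 :: complex fps) ^ u =
      (\<Sum>v\<le>u. of_nat (u choose v) * (- fps_exp (-1)) ^ v * fps_exp 1 ^ (u - v))"
    by (rule binomial_ring)
  also have "\<dots> = (\<Sum>v\<le>u. fps_const ((-1) ^ v * of_nat (u choose v)) * fps_exp (of_int (int u - 2 * int v)))"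
  proof (intro sum.cong refl)
    fix v assume "v \<in> {..u}"
    have "(- fps_exp (-1) :: complex fps) ^ v = fps_const ((-1) ^ v) * fps_exp (- of_nat v)"
      by (cases "even v") (simp_all add: fps_exp_power_mult flip: fps_const_neg)
    with \<open>v \<in> {..u}\<close> show "of_nat (u choose v) * (- fps_exp (-1)) ^ v * fps_exp 1 ^ (u - v) =
      fps_const ((-1) ^ v * of_nat (u choose v)) * fps_exp (of_int (int u - 2 * int v) :: complex)"
      by (simp add: fps_exp_power_mult of_nat_diff fps_of_nat algebra_simps flip: fps_const_mult fps_exp_add_mult)
  qed
  finally show ?thesis
    by (simp add: fps_X_sinhc power_mult_distrib fps_const_power power_divide)
qed

text \<open>Multiplication by \<open>fps_X ^ u\<close> turns the powers of \<open>sinh w / w\<close>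
  into powers of \<open>sinh w\<close>, so that the product is a finite sum of exponentials. The
  price is that the coefficient is read off at index \<open>k + u\<close>.\<close>

lemma fps_cosh_sinhc_nth:
  "(fps_cosh ^ m * fps_sinhc ^ u) $ k =
     (\<Sum>l\<le>m. \<Sum>v\<le>u. (-1) ^ v * of_nat (m choose l) * of_nat (u choose v) *
        (of_int (int m - 2 * int l + int u - 2 * int v) ^ (k + u) / (2 ^ (m + u) * fact (k + u))))"
proof -
  have "(fps_cosh ^ m * fps_sinhc ^ u) $ k = (fps_X ^ u * (fps_cosh ^ m * fps_sinhc ^ u)) $ (k + u)"
    by (simp add: fps_X_power_mult_nth)
  also have "fps_X ^ u * (fps_cosh ^ m * fps_sinhc ^ u) = fps_cosh ^ m * (fps_X * fps_sinhc) ^ u"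
    by (simp add: power_mult_distrib ac_simps)
  also have "\<dots> = (\<Sum>l\<le>m. \<Sum>v\<le>u.
      fps_const ((-1) ^ v * of_nat (m choose l) * of_nat (u choose v) / 2 ^ (m + u)) *
      fps_exp (of_int (int m - 2 * int l + int u - 2 * int v)))"
    unfolding fps_cosh_power fps_X_sinhc_power
  proof -
    define A where "A = (\<lambda>l. of_nat (m choose l) :: complex)"
    define B where "B = (\<lambda>v. (-1) ^ v * of_nat (u choose v) :: complex)"
    have "fps_const (A l) * fps_exp (of_int (int m - 2 * int l)) *
        (fps_const (B v) * fps_exp (of_int (int u - 2 * int v))) * fps_const (1 / 2 ^ (m + u)) =
        fps_const (A l * B v / 2 ^ (m + u)) * fps_exp (of_int (int m - 2 * int l + int u - 2 * int v))" for l v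
    proof -
      have "fps_exp (of_int (int m - 2 * int l + int u - 2 * int v) :: complex) =
          fps_exp (of_int (int m - 2 * int l)) * fps_exp (of_int (int u - 2 * int v))"
        by (simp add: algebra_simps flip: fps_exp_add_mult)
      moreover have "fps_const (A l * B v / 2 ^ (m + u)) =
          fps_const (A l) * fps_const (B v) * fps_const (1 / 2 ^ (m + u))"
        by simp
      ultimately show ?thesis by (simp only: ac_simps)
    qed
    note eq = this
    have "fps_const (1 / 2 ^ m) * (\<Sum>l\<le>m. fps_const (A l) * fps_exp (of_int (int m - 2 * int l))) *
        (fps_const (1 / 2 ^ u) * (\<Sum>v\<le>u. fps_const (B v) * fps_exp (of_int (int u - 2 * int v)))) =
        (\<Sum>l\<le>m. fps_const (A l) * fps_exp (of_int (int m - 2 * int l))) *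
        (\<Sum>v\<le>u. fps_const (B v) * fps_exp (of_int (int u - 2 * int v))) *
        (fps_const (1 / 2 ^ m) * fps_const (1 / 2 ^ u))"
      by (simp only: ac_simps)
    also have "fps_const (1 / 2 ^ m) * fps_const (1 / 2 ^ u) = fps_const (1 / 2 ^ (m + u) :: complex)"
      by (simp add: power_add)
    also have "(\<Sum>l\<le>m. fps_const (A l) * fps_exp (of_int (int m - 2 * int l))) *
        (\<Sum>v\<le>u. fps_const (B v) * fps_exp (of_int (int u - 2 * int v))) *
        fps_const (1 / 2 ^ (m + u)) = (\<Sum>l\<le>m. \<Sum>v\<le>u.
          fps_const (A l * B v / 2 ^ (m + u)) * fps_exp (of_int (int m - 2 * int l + int u - 2 * int v)))"
      by (subst sum_product) (simp only: sum_distrib_right eq)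
    finally have *: "fps_const (1 / 2 ^ m) * (\<Sum>l\<le>m. fps_const (A l) * fps_exp (of_int (int m - 2 * int l))) *
        (fps_const (1 / 2 ^ u) * (\<Sum>v\<le>u. fps_const (B v) * fps_exp (of_int (int u - 2 * int v)))) =
        (\<Sum>l\<le>m. \<Sum>v\<le>u.
          fps_const (A l * B v / 2 ^ (m + u)) * fps_exp (of_int (int m - 2 * int l + int u - 2 * int v)))" .
    have AB: "A l * B v = (-1) ^ v * of_nat (m choose l) * of_nat (u choose v)" for l v
      by (simp add: A_def B_def)
    show "fps_const (1 / 2 ^ m) * (\<Sum>l\<le>m. fps_const (of_nat (m choose l)) * fps_exp (of_int (int m - 2 * int l))) *
        (fps_const (1 / 2 ^ u) * (\<Sum>v\<le>u. fps_const ((-1) ^ v * of_nat (u choose v)) * fps_exp (of_int (int u - 2 * int v)))) =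
        (\<Sum>l\<le>m. \<Sum>v\<le>u.
      fps_const ((-1) ^ v * of_nat (m choose l) * of_nat (u choose v) / 2 ^ (m + u)) *
      fps_exp (of_int (int m - 2 * int l + int u - 2 * int v) :: complex))"
      using * unfolding AB unfolding A_def B_def .
  qed
  also have "\<dots> $ (k + u) = (\<Sum>l\<le>m. \<Sum>v\<le>u. (-1) ^ v * of_nat (m choose l) * of_nat (u choose v) *
        (of_int (int m - 2 * int l + int u - 2 * int v) ^ (k + u) / (2 ^ (m + u) * fact (k + u))))"
    by (simp add: fps_sum_nth)
  finally show ?thesis .
qed

text \<open>Here the triple sum \<open>S\<close> arises: \<open>u\<close> indexes the powers of
  \<open>fps_sinhc\<close> in the truncated series, while \<open>l\<close> and \<open>v\<close> come
  from the binomial expansions of the powers of \<open>cosh\<close> and \<open>sinh\<close>.\<close>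

lemma fps_coth_pow_nth:
  assumes "1 \<le> j" "j \<le> m"
  shows "fps_coth_pow m $ (m - j) = of_nat ((m + m div 2) choose m) * complex_of_real (S m j)"
proof -
  define M where "M = m div 2"
  define c where "c u = real ((m + M) choose m) * (real m / real (m + u)) * real (M choose u)" for u
  define P where "P = (\<Sum>i\<le>M. of_nat ((m + i - 1) choose i) * (1 - fps_sinhc) ^ i)"
  have m: "m > 0" using assms by simp
  have "fps_coth_pow m $ (m - j) =
      (\<Sum>i=0..m-j. (fps_cosh ^ m) $ i * (inverse fps_sinhc ^ m) $ (m - j - i))"
    by (simp add: fps_coth_pow_def fps_mult_nth)
  \<comment> \<open>Truncation at order \<open>M\<close> is exact here: only coefficients of index
    at most \<open>m - j\<close> occur, and \<open>m <= 2 * M + 1\<close>.\<close>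
  also have "\<dots> = (\<Sum>i=0..m-j. (fps_cosh ^ m) $ i * P $ (m - j - i))"
    unfolding P_def by (intro sum.cong refl arg_cong2[of _ _ _ _ "(*)"] inverse_power_truncation m)
       (auto simp: M_def)
  also have "\<dots> = (fps_cosh ^ m * P) $ (m - j)"
    by (simp add: fps_mult_nth)
  also have "P = (\<Sum>u\<le>M. fps_const ((-1) ^ u * of_real (c u)) * fps_sinhc ^ u)"
  proof -
    have "(1 - fps_sinhc) ^ i = (\<Sum>u\<le>M. of_nat (i choose u) * (fps_const ((-1) ^ u) * fps_sinhc ^ u))"
      if "i \<le> M" for i
    proof -
      have "(- fps_sinhc + 1) ^ i = (\<Sum>u\<le>i. of_nat (i choose u) * (- fps_sinhc) ^ u * 1 ^ (i - u))"
        by (rule binomial_ring)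
      also have "\<dots> = (\<Sum>u\<le>i. of_nat (i choose u) * (fps_const ((-1) ^ u) * fps_sinhc ^ u))"
      proof (intro sum.cong refl)
        fix u show "of_nat (i choose u) * (- fps_sinhc) ^ u * 1 ^ (i - u) =
            of_nat (i choose u) * (fps_const ((-1) ^ u) * fps_sinhc ^ u)"
          by (cases "even u") (simp_all flip: fps_const_neg)
      qed
      \<comment> \<open>Padding with vanishing binomial coefficients gives all \<open>i\<close> the
        same range of \<open>u\<close>, so that the two sums can be swapped.\<close>
      also have "\<dots> = (\<Sum>u\<le>M. of_nat (i choose u) * (fps_const ((-1) ^ u) * fps_sinhc ^ u))"
        by (rule sum.mono_neutral_left) (use that in \<open>auto simp: binomial_eq_0\<close>)
      finally show ?thesis by simp
    qed
    then have "P = (\<Sum>i\<le>M. \<Sum>u\<le>M. of_nat ((m + i - 1) choose i) *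
        (of_nat (i choose u) * (fps_const ((-1) ^ u) * fps_sinhc ^ u)))"
      unfolding P_def by (simp add: sum_distrib_left)
    also have "\<dots> = (\<Sum>u\<le>M. \<Sum>i\<le>M. of_nat ((m + i - 1) choose i) *
        (of_nat (i choose u) * (fps_const ((-1) ^ u) * fps_sinhc ^ u)))"
      by (rule sum.swap)
    also have "\<dots> = (\<Sum>u\<le>M. fps_const ((-1) ^ u * of_real (c u)) * fps_sinhc ^ u)"
    proof (intro sum.cong refl)
      fix u
      have "of_real (c u) = (\<Sum>i\<le>M. of_nat ((m + i - 1) choose i) * of_nat (i choose u) :: complex)"
        unfolding c_def by (subst sum_choose_mult_choose[OF m, symmetric]) simp
      then have "fps_const (of_real (c u) :: complex) =
          (\<Sum>i\<le>M. of_nat ((m + i - 1) choose i) * of_nat (i choose u))"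
        by (intro fps_ext) (simp add: fps_sum_nth fps_mult_left_const_nth flip: fps_of_nat)
      then show "(\<Sum>i\<le>M. of_nat ((m + i - 1) choose i) *
        (of_nat (i choose u) * (fps_const ((-1) ^ u) * fps_sinhc ^ u))) =
        fps_const ((-1) ^ u * of_real (c u)) * fps_sinhc ^ u"
        by (simp add: sum_distrib_right mult.assoc flip: fps_const_mult)
           (simp add: sum_distrib_left sum_distrib_right ac_simps)
    qed
    finally show ?thesis .
  qed
  also have "(fps_cosh ^ m * (\<Sum>u\<le>M. fps_const ((-1) ^ u * of_real (c u)) * fps_sinhc ^ u)) $ (m - j)
      = (\<Sum>u\<le>M. (-1) ^ u * of_real (c u) * (fps_cosh ^ m * fps_sinhc ^ u) $ (m - j))"
    by (simp add: sum_distrib_left fps_sum_nth mult.left_commute[of "fps_cosh ^ m"])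
  also have "\<dots> = (\<Sum>u\<le>M. \<Sum>l\<le>m. \<Sum>v\<le>u. (-1) ^ u * of_real (c u) *
        ((-1) ^ v * of_nat (m choose l) * of_nat (u choose v) *
        (of_int (int m - 2 * int l + int u - 2 * int v) ^ (m + u - j) / (2 ^ (m + u) * fact (m + u - j)))))"
    using assms by (simp add: fps_cosh_sinhc_nth sum_distrib_left)
  also have "\<dots> = (\<Sum>l\<le>m. \<Sum>u\<le>M. \<Sum>v\<le>u. (-1) ^ u * of_real (c u) *
        ((-1) ^ v * of_nat (m choose l) * of_nat (u choose v) *
        (of_int (int m - 2 * int l + int u - 2 * int v) ^ (m + u - j) / (2 ^ (m + u) * fact (m + u - j)))))"
    by (rule sum.swap)
  also have "\<dots> = of_nat ((m + M) choose m) * complex_of_real (S m j)"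
    unfolding S_def M_def[symmetric] c_def atLeast0AtMost
    by (simp add: sum_distrib_left power_add ac_simps)
  finally show ?thesis by (simp only: M_def)
qed

text \<open>The function \<open>w coth w\<close> is even, so its power series is unchanged under
  composition with \<open>-w\<close>. This removes from the residue all \<open>j\<close> whose
  parity differs from that of \<open>m\<close>.\<close>

lemma fps_coth_pow_nth_odd:
  assumes "odd k"
  shows "fps_coth_pow m $ k = 0"
proof -
  define N where "N = (fps_const (-1) * fps_X :: complex fps)"
  have [simp]: "N $ 0 = 0" by (simp add: N_def)
  have "fps_cosh oo N = fps_cosh" "fps_sinhc oo N = fps_sinhc"
    unfolding N_def fps_cosh_def fps_sinhc_def
    by (auto intro!: fps_ext simp: uminus_power_if simp del: fps_const_neg)
  then have "fps_coth_pow m oo N = fps_coth_pow m"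
    unfolding fps_coth_pow_def
    by (simp add: fps_compose_mult_distrib fps_inverse_compose flip: fps_compose_power)
  then have "fps_coth_pow m $ k = (-1) ^ k * fps_coth_pow m $ k"
    by (metis N_def fps_nth_compose_linear)
  with assms show ?thesis by simp
qed

section \<open>Poles and residues\<close>

text \<open>The terms with even base add up to \<open>1 / 2 ^ s\<close> times the whole series, and
  are subtracted from it.\<close>

lemma zeta_odd_sums:
  assumes "s \<ge> 2"
  shows "(\<lambda>k. 1 / of_nat (2 * k + 1) ^ s) sums ((1 - 1 / 2 ^ s) * zeta (of_nat s))"
proof -
  define a where "a k = 1 / (of_nat (Suc k) :: complex) ^ s" for k
  have "summable (\<lambda>k. inverse ((of_nat k :: complex) ^ s))"
    by (rule inverse_power_summable) (use assms in simp)
  then have "summable a"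
    unfolding a_def by (subst (asm) summable_Suc_iff [symmetric]) (simp add: field_simps)
  moreover have "a = (\<lambda>k. 1 / of_nat (Suc k) powr of_nat s)"
    unfolding a_def by (subst powr_nat') (use assms in auto)
  ultimately have *: "a sums zeta (of_nat s)"
    unfolding zeta_def by (simp add: summable_sums)
  \<comment> \<open>Since \<open>a\<close> starts at base 1, the even index \<open>2 * k\<close>
    carries the odd base \<open>2 * k + 1\<close>, and the odd index \<open>2 * k + 1\<close> the
    even base.\<close>
  have "(\<lambda>k. a (2 * k) + a (2 * k + 1)) sums zeta (of_nat s)"
    using sums_group[OF *, of 2] by (simp add: mult.commute)
  moreover have "a (2 * k + 1) = 1 / 2 ^ s * a k" for k
  proof -
    have "of_nat (Suc (2 * k + 1)) = (2 :: complex) * of_nat (Suc k)" by simp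
    then show ?thesis by (simp only: a_def power_mult_distrib) simp
  qed
  then have "(\<lambda>k. a (2 * k + 1)) sums (1 / 2 ^ s * zeta (of_nat s))"
    using sums_mult[OF *, of "1 / 2 ^ s"] by simp
  ultimately have "(\<lambda>k. a (2 * k)) sums (zeta (of_nat s) - 1 / 2 ^ s * zeta (of_nat s))"
    using sums_diff by fastforce
  then show ?thesis by (simp add: a_def algebra_simps)
qed

text \<open>These are the zeros of \<open>cosh\<close> in the upper half-plane. The odd integer is
  kept as a factor so that sums of inverse powers reduce to zeta values.\<close>

definition tanh_pole :: "nat \<Rightarrow> complex" where
  "tanh_pole k = of_real pi * \<i> * of_nat (2 * k + 1) / 2"

lemma tanh_pole_zeta_sums:
  assumes "s \<ge> 2"
  shows "(\<lambda>k. 1 / tanh_pole k ^ s) sums ((2 ^ s - 1) / (of_real pi * \<i>) ^ s * zeta (of_nat s))"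
proof -
  have "(\<lambda>k. 2 ^ s / (of_real pi * \<i>) ^ s * (1 / of_nat (2 * k + 1) ^ s)) sums
      (2 ^ s / (of_real pi * \<i>) ^ s * ((1 - 1 / 2 ^ s) * zeta (of_nat s)))"
    by (intro sums_mult zeta_odd_sums assms)
  moreover have "2 ^ s / (of_real pi * \<i>) ^ s * ((1 - 1 / 2 ^ s) * zeta (of_nat s)) =
      (2 ^ s - 1) / (of_real pi * \<i>) ^ s * zeta (of_nat s)"
    by (simp add: algebra_simps divide_simps)
  moreover have "2 ^ s / (of_real pi * \<i>) ^ s * (1 / of_nat (2 * k + 1) ^ s) = 1 / tanh_pole k ^ s" for k
    by (simp add: tanh_pole_def power_divide power_mult_distrib)
  ultimately show ?thesis
    by (simp only:)
qed

section \<open>Zeros of cosh and the behaviour of tanh near them\<close>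

lemma cosh_complex_eq_0_iff:
  "cosh (z :: complex) = 0 \<longleftrightarrow> (\<exists>k::int. z = of_real (pi * (real_of_int k + 1 / 2)) * \<i>)"
proof -
  have "cosh z = cos (\<i> * z)"
    by (simp add: cosh_def cos_exp_eq scaleR_conv_of_real mult.assoc[symmetric])
  also have "\<dots> = 0 \<longleftrightarrow> (\<exists>k::int. \<i> * z = of_real (real_of_int k * pi) + of_real pi / 2)"
    by (simp add: cos_eq_0)
  also have "\<dots> \<longleftrightarrow> (\<exists>k::int. z = of_real (pi * (real_of_int k + 1 / 2)) * \<i>)"
  proof
    assume "\<exists>k::int. \<i> * z = of_real (real_of_int k * pi) + of_real pi / 2"
    then obtain k :: int where k: "\<i> * z = of_real (real_of_int k * pi) + of_real pi / 2" by blast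
    have "z = - \<i> * (\<i> * z)" by simp
    \<comment> \<open>Dividing by the imaginary unit reverses the sign, and
      \<open>-(k + 1/2) = (-k - 1) + 1/2\<close>.\<close>
    also have "\<dots> = of_real (pi * (real_of_int (- k - 1) + 1 / 2)) * \<i>"
      unfolding k by (simp add: algebra_simps)
    finally show "\<exists>k::int. z = of_real (pi * (real_of_int k + 1 / 2)) * \<i>" by blast
  next
    assume "\<exists>k::int. z = of_real (pi * (real_of_int k + 1 / 2)) * \<i>"
    then obtain k :: int where k: "z = of_real (pi * (real_of_int k + 1 / 2)) * \<i>" by blast
    have "\<i> * z = of_real (real_of_int (- k - 1) * pi) + of_real pi / 2"
      unfolding k by (simp add: algebra_simps)
    then show "\<exists>k::int. \<i> * z = of_real (real_of_int k * pi) + of_real pi / 2" by blast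
  qed
  finally show ?thesis .
qed

lemma tanh_pole_nonzero [simp]: "tanh_pole k \<noteq> 0"
  by (auto simp: tanh_pole_def complex_eq_iff)

text \<open>At the pole \<open>cosh\<close> vanishes, so the addition formulas exchange
  \<open>sinh\<close> and \<open>cosh\<close> up to one common factor. Where
  \<open>sinh w = 0\<close>, both sides are 0 by the convention for division.\<close>

lemma tanh_add_tanh_pole:
  "tanh (tanh_pole k + w) = cosh w / sinh w"
proof -
  have cosh_i: "cosh (of_real x * \<i>) = complex_of_real (cos x)"
    and sinh_i: "sinh (of_real x * \<i>) = \<i> * complex_of_real (sin x)" for x
    by (simp_all add: cosh_conv_cos sinh_conv_sin mult.left_commute[of \<i>] cos_of_real sin_of_real)
  have k: "tanh_pole k = of_real (real k * pi + pi / 2) * \<i>"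
    by (simp add: tanh_pole_def field_simps)
  have "sinh (tanh_pole k) = \<i> * (-1) ^ k" "cosh (tanh_pole k) = 0"
    unfolding k cosh_i sinh_i by (simp_all add: cos_add sin_add)
  then have "sinh (tanh_pole k + w) = \<i> * (-1) ^ k * cosh w" "cosh (tanh_pole k + w) = \<i> * (-1) ^ k * sinh w"
    by (simp_all add: sinh_add cosh_add)
  then show ?thesis by (simp add: tanh_def)
qed

section \<open>Local expansions and the residue\<close>

lemma has_fps_expansion_cosh: "cosh has_fps_expansion fps_cosh"
proof -
  have "(\<lambda>z. 1 / 2 * (exp z + exp (- z))) has_fps_expansion fps_cosh"
    unfolding fps_cosh_def by (intro fps_expansion_intros)
  then show ?thesis by (simp add: cosh_def [abs_def] scaleR_conv_of_real)
qed

lemma has_fps_expansion_sinhc: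
  "(\<lambda>z. if z = 0 then 1 else sinh z / z) has_fps_expansion fps_sinhc"
proof -
  have "(\<lambda>z. 1 / 2 * (exp z - exp (- z) :: complex)) has_fps_expansion (fps_const (1 / 2) * (fps_exp 1 - fps_exp (-1)))"
    by (intro fps_expansion_intros)
  then have *: "sinh has_fps_expansion (fps_const (1 / 2 :: complex) * (fps_exp 1 - fps_exp (-1)))"
    by (simp add: sinh_def [abs_def] scaleR_conv_of_real)
  have "1 \<le> subdegree (fps_const (1 / 2 :: complex) * (fps_exp 1 - fps_exp (-1)))"
    by (rule subdegree_geI) (auto simp: fps_eq_iff intro!: exI[of _ 1])
  from has_fps_expansion_shift[OF * this refl] show ?thesis
    by (simp add: fps_sinhc_def cong: if_cong)
qed

text \<open>Factoring out \<open>a ^ n\<close> leaves a negative power of \<open>1 + z / a\<close>,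
  whose binomial series yields the generalized binomial coefficients of the theorem.\<close>

lemma has_fps_expansion_inverse_power_shift:
  fixes a :: complex
  assumes "a \<noteq> 0"
  shows "(\<lambda>z. inverse ((a + z) ^ n)) has_fps_expansion
    Abs_fps (\<lambda>k. ((- of_nat n) gchoose k) / a ^ (n + k))"
proof -
  have "(\<lambda>z. inverse ((a + z) ^ n)) has_fps_expansion inverse ((fps_const a + fps_X) ^ n)"
    using assms by (intro fps_expansion_intros) (simp add: fps_power_zeroth)
  also have "(fps_const a + fps_X) ^ n = fps_const (a ^ n) * (1 - fps_const (- 1 / a) * fps_X) ^ n"
  proof -
    have "fps_const a + fps_X = fps_const a * (1 - fps_const (- 1 / a) * fps_X)"
      using assms by (intro fps_ext) (auto simp: fps_X_def)
    then show ?thesis by (simp only: power_mult_distrib fps_const_power)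
  qed
  also have "inverse \<dots> = fps_const (inverse (a ^ n)) * (fps_binomial (- of_nat n) oo (fps_const (1 / a) * fps_X))"
    unfolding fps_inverse_mult one_minus_fps_X_const_neg_power by (simp add: fps_const_inverse)
  also have "\<dots> = Abs_fps (\<lambda>k. ((- of_nat n) gchoose k) / a ^ (n + k))"
    by (intro fps_ext) (simp add: power_divide power_add, simp add: field_simps)
  finally show ?thesis .
qed

lemma residue_tanh_power:
  assumes "m > 0"
  shows "residue (\<lambda>z. tanh z ^ m / z ^ n) (tanh_pole k) =
    (\<Sum>j=1..m. fps_coth_pow m $ (m - j) * ((- of_nat n) gchoose (j - 1)) / tanh_pole k ^ (n + j - 1))"
proof -
  define H where "H = Abs_fps (\<lambda>i. ((- of_nat n) gchoose i) / tanh_pole k ^ (n + i))"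
  \<comment> \<open>Filling in the value 1 at 0 makes \<open>G\<close> analytic there, while
    \<open>tanh (tanh_pole k + w) ^ m = G w / w ^ m\<close> for \<open>w\<close> near but different
    from 0. The residue is therefore the coefficient of index \<open>m - 1\<close> in a Cauchy
    product.\<close>
  define G where "G = (\<lambda>w::complex. cosh w ^ m * inverse (if w = 0 then 1 else sinh w / w) ^ m)"
  have "(\<lambda>w. G w * inverse ((tanh_pole k + w) ^ n)) has_fps_expansion fps_coth_pow m * H"
    unfolding G_def H_def fps_coth_pow_def
    by (intro has_fps_expansion_mult has_fps_expansion_power has_fps_expansion_inverse
        has_fps_expansion_cosh has_fps_expansion_sinhc has_fps_expansion_inverse_power_shift) auto
  note residue_fps_expansion_over_power_at_0[OF this, of "m - 1"]
  also have "residue (\<lambda>w. G w * inverse ((tanh_pole k + w) ^ n) / w ^ Suc (m - 1)) 0 =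
      residue (\<lambda>w. tanh (tanh_pole k + w) ^ m / (tanh_pole k + w) ^ n) 0"
  proof (rule residue_cong)
    show "\<forall>\<^sub>F w in at 0. G w * inverse ((tanh_pole k + w) ^ n) / w ^ Suc (m - 1) =
      tanh (tanh_pole k + w) ^ m / (tanh_pole k + w) ^ n"
      using eventually_neq_at_within[of 0]
      by eventually_elim (use assms in \<open>simp add: G_def tanh_add_tanh_pole power_mult_distrib power_divide divide_simps\<close>)
  qed simp
  also have "\<dots> = residue (\<lambda>z. tanh z ^ m / z ^ n) (tanh_pole k)"
    by (rule residue_shift_0 [symmetric])
  finally have "residue (\<lambda>z. tanh z ^ m / z ^ n) (tanh_pole k) =
      (\<Sum>i=0..m - 1. fps_coth_pow m $ i * H $ (m - 1 - i))"
    by (simp add: fps_mult_nth)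
  also have "\<dots> = (\<Sum>j=1..m. fps_coth_pow m $ (m - j) * H $ (j - 1))"
    by (rule sum.reindex_bij_witness[of _ "\<lambda>j. m - j" "\<lambda>i. m - i"]) (use assms in auto)
  also have "\<dots> = (\<Sum>j=1..m. fps_coth_pow m $ (m - j) * ((- of_nat n) gchoose (j - 1)) / tanh_pole k ^ (n + j - 1))"
    by (intro sum.cong refl) (simp add: H_def)
  finally show ?thesis .
qed

section \<open>The contour integral\<close>

text \<open>For \<open>n <= m\<close> this is the integrand with its singularity at 0 removed, so
  that the lower side of the rectangle may run through the origin.\<close>

definition tanh_ratio :: "nat \<Rightarrow> nat \<Rightarrow> complex \<Rightarrow> complex" where
  "tanh_ratio m n z = (if z = 0 then 1 else tanh z / z) ^ n * tanh z ^ (m - n)"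

lemma tanh_ratio_eq:
  assumes "n \<le> m" "z \<noteq> 0"
  shows "tanh_ratio m n z = tanh z ^ m / z ^ n"
  using assms by (simp add: tanh_ratio_def power_divide flip: power_add)

lemma open_cosh_nonzero: "open {z::complex. cosh z \<noteq> 0}"
  by (intro open_Collect_neq continuous_intros)

lemma holomorphic_tanh_ratio: "tanh_ratio m n holomorphic_on {z. cosh z \<noteq> 0}"
proof -
  have tanh: "(tanh :: complex \<Rightarrow> complex) holomorphic_on {z. cosh z \<noteq> 0}"
    unfolding holomorphic_on_open[OF open_cosh_nonzero]
    by (auto intro!: exI derivative_eq_intros)
  have "(tanh has_field_derivative (1 :: complex)) (at 0)"
    by (auto intro!: derivative_eq_intros)
  then have "deriv tanh (0 :: complex) = 1" by (rule DERIV_imp_deriv)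
  \<comment> \<open>The quotient \<open>tanh z / z\<close> is the difference quotient of
    \<open>tanh\<close> at 0. It becomes holomorphic when given the derivative 1 as its value
    there.\<close>
  with pole_lemma_open[OF tanh open_cosh_nonzero, of 0]
  have "(\<lambda>z. if z = 0 then 1 else tanh z / z :: complex) holomorphic_on {z. cosh z \<noteq> 0}"
    by (simp cong: if_cong)
  then show ?thesis
    unfolding tanh_ratio_def [abs_def] by (intro holomorphic_intros tanh)
qed

section \<open>Bounds away from the real axis\<close>

lemma norm_tanh_le_2:
  assumes "\<bar>Re z\<bar> \<ge> 1"
  shows "norm (tanh z) \<le> 2"
proof -
  have *: "norm (tanh z) \<le> 2" if "Re z \<ge> 1" for z :: complex
  proof -
    have e: "exp (Re z) \<ge> 2"
      using exp_ge_add_one_self[of "Re z"] that by linarith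
    then have "exp (- Re z) \<le> 1 / 2"
      by (simp add: exp_minus field_simps)
    \<comment> \<open>With \<open>exp (Re z) >= 2\<close>, the ratio of the sum to the difference is
      at most \<open>(5/2) / (3/2) < 2\<close>.\<close>
    with e have ineq: "exp (Re z) + exp (- Re z) \<le> 2 * (exp (Re z) - exp (- Re z))"
      "0 < exp (Re z) - exp (- Re z)"
      by argo+
    have lower: "exp (Re z) - exp (- Re z) \<le> 2 * norm (cosh z)"
      using norm_diff_ineq[of "exp z" "exp (- z)"] by (simp add: cosh_def norm_exp_eq_Re)
    have "2 * norm (sinh z) = norm (exp z - exp (- z))"
      by (simp add: sinh_def)
    also have "\<dots> \<le> exp (Re z) + exp (- Re z)"
      using norm_triangle_ineq4[of "exp z" "exp (- z)"] by (simp add: norm_exp_eq_Re)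
    also note ineq(1)
    also have "2 * (exp (Re z) - exp (- Re z)) \<le> 2 * (2 * norm (cosh z))"
      using lower by simp
    finally have "norm (sinh z) \<le> 2 * norm (cosh z)" by simp
    moreover have "norm (cosh z) > 0" using ineq lower by linarith
    ultimately show ?thesis by (simp add: tanh_def norm_divide field_simps)
  qed
  show ?thesis
    using *[of z] *[of "-z"] assms by (cases "Re z \<ge> 0") auto
qed

lemma tanh_add_pi_i: "tanh (z + of_nat N * (of_real pi * \<i>)) = tanh z"
proof (induction N)
  case (Suc N)
  have "sinh (w + of_real pi * \<i>) = - sinh w" "cosh (w + of_real pi * \<i>) = - cosh w" for w
    by (simp_all add: sinh_def cosh_def exp_add exp_diff exp_minus algebra_simps)
  then have "tanh (w + of_real pi * \<i>) = tanh w" for w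
    by (simp add: tanh_def)
  from this[of "z + of_nat N * (of_real pi * \<i>)"] Suc show ?case
    by (simp add: algebra_simps)
qed auto

lemma cosh_complex_of_real: "cosh (complex_of_real x) = of_real (cosh x)"
  by (simp add: cosh_def scaleR_conv_of_real flip: exp_of_real)

lemma tanh_complex_of_real: "tanh (complex_of_real x) = of_real (tanh x)"
  by (simp add: tanh_def cosh_def sinh_def scaleR_conv_of_real flip: exp_of_real)

lemma norm_tanh_ratio_le:
  assumes "n \<le> m" "n \<ge> 2" "N \<ge> 1" "norm z \<ge> real N" "\<bar>Re z\<bar> \<ge> 1 \<or> Im z = pi * real N"
  shows "norm (tanh_ratio m n z) \<le> 2 ^ m / real N ^ 2"
proof -
  have "norm (tanh z) \<le> 2"
  proof (cases "\<bar>Re z\<bar> \<ge> 1")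
    case False
    with assms have "Im z = pi * real N" by simp
    \<comment> \<open>On the line \<open>Im z = pi * N\<close>, periodicity reduces
      \<open>tanh\<close> to its values on the real axis, which are bounded by 1.\<close>
    then have "z = of_real (Re z) + of_nat N * (of_real pi * \<i>)"
      by (simp add: complex_eq_iff)
    then have "tanh z = of_real (tanh (Re z))"
      by (metis tanh_add_pi_i tanh_complex_of_real)
    then have "norm (tanh z) = \<bar>tanh (Re z)\<bar>"
      by simp
    also have "\<dots> \<le> 1"
      using tanh_real_bounds[of "Re z"] by auto
    finally show ?thesis by simp
  qed (rule norm_tanh_le_2)
  then have "norm (tanh z) ^ m \<le> 2 ^ m"
    by (intro power_mono) auto
  moreover have "real N ^ 2 \<le> real N ^ n"
    using assms by (intro power_increasing) auto
  then have "real N ^ 2 \<le> norm z ^ n"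
    using power_mono[OF assms(4), of n] by linarith
  moreover have "z \<noteq> 0" using assms by auto
  ultimately show ?thesis
    using assms by (simp add: tanh_ratio_eq norm_divide norm_power) (intro frac_le, auto)
qed

text \<open>The zeros nearest to the lines \<open>Im z = 0\<close> and \<open>Im z = pi * N\<close>
  lie at distance \<open>pi / 2 > 1\<close>. Widening the strip by 1 on both sides thus adds no
  zeros.\<close>

lemma cosh_zero_in_tanh_poles:
  assumes "cosh z = 0" "-1 < Im z" "Im z < pi * real N + 1"
  shows "z \<in> tanh_pole ` {..<N}"
proof -
  obtain k :: int where k: "z = of_real (pi * (real_of_int k + 1 / 2)) * \<i>"
    using assms(1) cosh_complex_eq_0_iff by blast
  have 2: "pi > 2" using pi_gt3 by simp
  have "k \<ge> 0"
  proof (rule ccontr)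
    assume "\<not> k \<ge> 0"
    then have "real_of_int k + 1 / 2 \<le> - 1 / 2" by simp
    then have "pi * (real_of_int k + 1 / 2) \<le> pi * (- 1 / 2)" by (intro mult_left_mono) auto
    with assms(2) 2 show False by (simp add: k)
  qed
  moreover have "k < int N"
  proof (rule ccontr)
    assume "\<not> k < int N"
    then have "real_of_int k + 1 / 2 \<ge> real N + 1 / 2" by linarith
    then have "pi * (real_of_int k + 1 / 2) \<ge> pi * (real N + 1 / 2)" by (intro mult_left_mono) auto
    moreover have "pi * (real N + 1 / 2) = pi * real N + pi / 2" by (simp add: algebra_simps)
    moreover have "Im z = pi * (real_of_int k + 1 / 2)" by (simp add: k)
    ultimately show False using assms(3) 2 by linarith
  qed
  ultimately have "nat k < N" "z = tanh_pole (nat k)"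
    by (auto simp: k tanh_pole_def complex_eq_iff field_simps)
  then show ?thesis by blast
qed

lemma inj_tanh_pole: "inj tanh_pole"
  by (auto simp: inj_def tanh_pole_def complex_eq_iff)

lemma contour_integral_tanh_ratio:
  assumes "n \<le> m" "N \<ge> 1"
  shows "contour_integral (rectpath (Complex (- real N) 0) (Complex (real N) (pi * real N))) (tanh_ratio m n) =
    2 * pi * \<i> * (\<Sum>k<N. residue (\<lambda>z. tanh z ^ m / z ^ n) (tanh_pole k))"
    and "\<And>z. z \<in> path_image (rectpath (Complex (- real N) 0) (Complex (real N) (pi * real N))) \<Longrightarrow> cosh z \<noteq> 0"
proof -
  define a b where "a = Complex (- real N) 0" and "b = Complex (real N) (pi * real N)"
  \<comment> \<open>An open convex neighbourhood of the closed rectangle: convexity gives winding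
    number 0 outside \<open>U\<close>, and the margin 1 admits no zeros of \<open>cosh\<close>
    beyond those in \<open>P\<close>.\<close>
  define U where "U = {z. -1 < Im z} \<inter> {z. Im z < pi * real N + 1}"
  define P where "P = tanh_pole ` {..<N}"
  have ab: "Re a \<le> Re b" "Im a \<le> Im b" by (simp_all add: a_def b_def)
  have U: "open U" "convex U"
    unfolding U_def by (auto intro!: open_Int open_halfspace_Im_gt open_halfspace_Im_lt convex_Int
        convex_halfspace_Im_gt convex_halfspace_Im_lt)
  have sub: "U - P \<subseteq> {z. cosh z \<noteq> 0}"
    using cosh_zero_in_tanh_poles[of _ N] by (auto simp: U_def P_def)
  have box: "p \<in> box a b" if p: "p \<in> P" for p
  proof -
    obtain k where k: "k < N" "p = tanh_pole k" using p by (auto simp: P_def)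
    have "pi * (real k + 1 / 2) < pi * real N"
      using k by (intro mult_strict_left_mono) auto
    moreover have "Re p = 0" "Im p = pi * (real k + 1 / 2)"
      by (simp_all add: k tanh_pole_def field_simps)
    ultimately show ?thesis
      using assms by (simp add: in_box_complex_iff a_def b_def)
  qed
  have img: "path_image (rectpath a b) \<subseteq> U - P"
  proof -
    have "path_image (rectpath a b) \<subseteq> cbox a b"
      by (rule path_image_rectpath_subset_cbox[OF ab])
    also have "cbox a b \<subseteq> U" by (auto simp: in_cbox_complex_iff U_def a_def b_def)
    finally show ?thesis using box path_image_rectpath_inter_box[OF ab] by blast
  qed
  show "cosh z \<noteq> 0" if "z \<in> path_image (rectpath (Complex (- real N) 0) (Complex (real N) (pi * real N)))" for z
    using that img sub unfolding a_def b_def by blast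
  have "contour_integral (rectpath a b) (tanh_ratio m n) =
      2 * pi * \<i> * (\<Sum>p\<in>P. winding_number (rectpath a b) p * residue (tanh_ratio m n) p)"
  proof (rule Residue_theorem)
    show "tanh_ratio m n holomorphic_on U - P"
      using holomorphic_tanh_ratio sub by (rule holomorphic_on_subset)
    show "\<forall>z. z \<notin> U \<longrightarrow> winding_number (rectpath a b) z = 0"
      using U(2) img by (auto intro!: winding_number_zero_outside[of _ U])
  qed (use U img in \<open>auto simp: P_def convex_connected\<close>)
  also have "(\<Sum>p\<in>P. winding_number (rectpath a b) p * residue (tanh_ratio m n) p) =
      (\<Sum>p\<in>P. residue (\<lambda>z. tanh z ^ m / z ^ n) p)"
  proof (intro sum.cong refl)
    fix p assume p: "p \<in> P"
    have "residue (tanh_ratio m n) p = residue (\<lambda>z. tanh z ^ m / z ^ n) p"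
    proof (rule residue_cong)
      have "p \<noteq> 0" using p by (auto simp: P_def)
      then have "\<forall>\<^sub>F z in nhds p. z \<noteq> 0" by (rule t1_space_nhds)
      then have "\<forall>\<^sub>F z in at p. z \<noteq> 0"
        by (rule filter_leD[OF at_within_le_nhds])
      then show "\<forall>\<^sub>F z in at p. tanh_ratio m n z = tanh z ^ m / z ^ n"
        by eventually_elim (use assms in \<open>simp add: tanh_ratio_eq\<close>)
    qed simp
    with winding_number_rectpath[OF box[OF p]]
    show "winding_number (rectpath a b) p * residue (tanh_ratio m n) p = residue (\<lambda>z. tanh z ^ m / z ^ n) p"
      by simp
  qed
  also have "\<dots> = (\<Sum>k<N. residue (\<lambda>z. tanh z ^ m / z ^ n) (tanh_pole k))"
    unfolding P_def by (subst sum.reindex) (auto intro: inj_on_subset[OF inj_tanh_pole])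
  finally show "contour_integral (rectpath (Complex (- real N) 0) (Complex (real N) (pi * real N))) (tanh_ratio m n) =
    2 * pi * \<i> * (\<Sum>k<N. residue (\<lambda>z. tanh z ^ m / z ^ n) (tanh_pole k))"
    unfolding a_def b_def .
qed

text \<open>The difference is minus the integral over the three sides off the real axis. Their total
  length is \<open>(2 * pi + 2) * N\<close>, and the integrand there is at most
  \<open>2 ^ m / N ^ 2\<close>.\<close>

lemma norm_contour_integral_tanh_ratio_diff_le:
  assumes "n \<le> m" "n \<ge> 2" "N \<ge> 1"
  shows "norm (contour_integral (linepath (of_real (- real N)) (of_real (real N))) (tanh_ratio m n) -
     2 * pi * \<i> * (\<Sum>k<N. residue (\<lambda>z. tanh z ^ m / z ^ n) (tanh_pole k))) \<le> 2 ^ m * (2 * pi + 2) / real N"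
proof -
  define a1 a2 a3 a4 where "a1 = Complex (- real N) 0" and "a2 = Complex (real N) 0"
    and "a3 = Complex (real N) (pi * real N)" and "a4 = Complex (- real N) (pi * real N)"
  let ?f = "tanh_ratio m n"
  have rect: "rectpath a1 a3 = linepath a1 a2 +++ linepath a2 a3 +++ linepath a3 a4 +++ linepath a4 a1"
    by (simp add: rectpath_def Let_def a1_def a2_def a3_def a4_def)
  have "path_image (rectpath a1 a3) \<subseteq> {z. cosh z \<noteq> 0}"
    using contour_integral_tanh_ratio(2)[OF assms(1,3)] by (auto simp: a1_def a3_def)
  then have "continuous_on (path_image (rectpath a1 a3)) ?f"
    by (rule continuous_on_subset[OF holomorphic_on_imp_continuous_on[OF holomorphic_tanh_ratio]])
  then have int: "?f contour_integrable_on linepath a1 a2" "?f contour_integrable_on linepath a2 a3"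
    "?f contour_integrable_on linepath a3 a4" "?f contour_integrable_on linepath a4 a1"
    by (auto intro!: contour_integrable_continuous_linepath elim!: continuous_on_subset
        simp: rect path_image_join)
  have eq: "contour_integral (linepath a1 a2) ?f + contour_integral (linepath a2 a3) ?f +
      contour_integral (linepath a3 a4) ?f + contour_integral (linepath a4 a1) ?f =
      2 * pi * \<i> * (\<Sum>k<N. residue (\<lambda>z. tanh z ^ m / z ^ n) (tanh_pole k))"
    using contour_integral_tanh_ratio(1)[OF assms(1,3)] int
    by (simp add: rect add.assoc flip: a1_def a3_def)
  define B where "B = 2 ^ m / real N ^ 2"
  have B: "B \<ge> 0" by (simp add: B_def)
  have re: "real N \<le> norm z" if "\<bar>Re z\<bar> = real N" for z
    using abs_Re_le_cmod[of z] that by simp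
  have im: "real N \<le> norm z" if "Im z = pi * real N" for z
  proof -
    have "1 * real N \<le> pi * real N" using pi_gt3 by (intro mult_right_mono) auto
    then show ?thesis using abs_Im_le_cmod[of z] that by simp
  qed
  have bnd: "norm (?f z) \<le> B"
    if "z \<in> closed_segment a2 a3 \<union> closed_segment a3 a4 \<union> closed_segment a4 a1" for z
  proof -
    have "\<bar>Re z\<bar> = real N \<or> Im z = pi * real N"
      using that by (auto simp: a1_def a2_def a3_def a4_def closed_segment_same_Re closed_segment_same_Im)
    then show ?thesis unfolding B_def
      using assms re[of z] im[of z] by (intro norm_tanh_ratio_le) auto
  qed
  have len: "norm (a3 - a2) = pi * real N" "norm (a4 - a3) = 2 * real N" "norm (a1 - a4) = pi * real N"
    by (simp_all add: a1_def a2_def a3_def a4_def cmod_def real_sqrt_mult)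
  have "norm (contour_integral (linepath a2 a3) ?f) \<le> B * norm (a3 - a2)"
    "norm (contour_integral (linepath a3 a4) ?f) \<le> B * norm (a4 - a3)"
    "norm (contour_integral (linepath a4 a1) ?f) \<le> B * norm (a1 - a4)"
    by (intro contour_integral_bound_linepath int B bnd; simp)+
  then have "norm (contour_integral (linepath a2 a3) ?f + contour_integral (linepath a3 a4) ?f +
      contour_integral (linepath a4 a1) ?f) \<le> B * (pi * real N) + B * (2 * real N) + B * (pi * real N)"
    unfolding len by (intro norm_triangle_le add_mono)
  also have "\<dots> = 2 ^ m * (2 * pi + 2) / real N"
    using assms by (simp add: B_def field_simps power2_eq_square)
  also have "contour_integral (linepath a2 a3) ?f + contour_integral (linepath a3 a4) ?f +
      contour_integral (linepath a4 a1) ?f =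
      - (contour_integral (linepath a1 a2) ?f - 2 * pi * \<i> * (\<Sum>k<N. residue (\<lambda>z. tanh z ^ m / z ^ n) (tanh_pole k)))"
    unfolding eq[symmetric] by simp
  finally have "norm (contour_integral (linepath a1 a2) ?f -
      2 * pi * \<i> * (\<Sum>k<N. residue (\<lambda>z. tanh z ^ m / z ^ n) (tanh_pole k))) \<le> 2 ^ m * (2 * pi + 2) / real N"
    by (simp only: norm_minus_cancel)
  moreover have "a1 = of_real (- real N)" "a2 = of_real (real N)"
    by (simp_all add: a1_def a2_def complex_eq_iff)
  ultimately show ?thesis by simp
qed

section \<open>Passage to the improper real integral\<close>

lemma has_integral_tanh_power_over_power:
  fixes L :: complex
  assumes "n \<ge> 2" "m \<ge> n" "even m \<longleftrightarrow> even n"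
    and L: "(\<lambda>k. residue (\<lambda>z. tanh z ^ m / z ^ n) (tanh_pole k)) sums L"
  shows "((\<lambda>z::real. complex_of_real (tanh z ^ m / z ^ n)) has_integral (of_real pi * \<i> * L)) {0<..}"
proof -
  define g where "g x = (if x = 0 then 1 else tanh x / x) ^ n * tanh x ^ (m - n)" for x :: real
  have ratio: "tanh_ratio m n (of_real x) = of_real (g x)" for x
    by (simp add: tanh_ratio_def g_def tanh_complex_of_real)
  have g_eq: "g x = tanh x ^ m / x ^ n" if "x \<noteq> 0" for x
    using that assms by (simp add: g_def power_divide flip: power_add)
  \<comment> \<open>This is where equal parity enters: \<open>tanh x / x\<close> is even, and
    \<open>m - n\<close> is even as well.\<close>
  have even: "g (- x) = g x" for x
    using assms(2,3) by (cases "x = 0") (auto simp: g_def power_minus_even)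
  have "continuous_on UNIV (\<lambda>x. tanh_ratio m n (of_real x))"
    by (rule continuous_on_compose2[OF holomorphic_on_imp_continuous_on[OF holomorphic_tanh_ratio]])
       (auto intro!: continuous_intros simp: cosh_complex_of_real)
  then have "continuous_on UNIV (\<lambda>x. Re (of_real (g x)))"
    unfolding ratio by (rule continuous_on_Re)
  then have cont: "continuous_on A g" for A
    by (auto elim: continuous_on_subset)
  then have int: "g integrable_on {a..b}" for a b
    by (rule integrable_continuous_real)
  define I where "I N = integral {0..real N} g" for N :: nat
  have line: "contour_integral (linepath (of_real (- real N)) (of_real (real N))) (tanh_ratio m n) =
      2 * of_real (I N)" if "N \<ge> 1" for N :: nat
  proof -
    have "integral {- real N..- 0} (\<lambda>x. g (- x)) = integral {0..real N} g"
      by (rule Henstock_Kurzweil_Integration.integral_reflect_real)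
    then have "integral {- real N..0} g = I N"
      by (simp add: even I_def)
    moreover have "integral {- real N..0} g + integral {0..real N} g = integral {- real N..real N} g"
      by (rule Henstock_Kurzweil_Integration.integral_combine) (use int in auto)
    ultimately have "integral {- real N..real N} g = 2 * I N"
      by (simp add: I_def)
    moreover have "((\<lambda>x. complex_of_real (g x)) has_integral of_real (integral {- real N..real N} g)) {- real N..real N}"
      by (intro has_integral_of_real integrable_integral int)
    ultimately show ?thesis
      using that by (subst contour_integral_linepath_Reals_eq) (auto simp: ratio dest: integral_unique)
  qed
  define R where "R N = 2 * of_real pi * \<i> * (\<Sum>k<N. residue (\<lambda>z. tanh z ^ m / z ^ n) (tanh_pole k))" for N
  have "R \<longlonglongrightarrow> 2 * of_real pi * \<i> * L"
    unfolding R_def [abs_def] using L by (intro tendsto_intros) (simp add: sums_def)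
  moreover have "(\<lambda>N. 2 * of_real (I N) - R N) \<longlonglongrightarrow> 0"
  proof (rule Lim_null_comparison)
    show "\<forall>\<^sub>F N in sequentially. norm (2 * of_real (I N) - R N) \<le> 2 ^ m * (2 * pi + 2) / real N"
      using eventually_ge_at_top[of 1]
    proof eventually_elim
      case (elim N)
      show ?case
        using norm_contour_integral_tanh_ratio_diff_le[OF assms(2,1) elim]
        unfolding line[OF elim] by (simp add: R_def)
    qed
    show "(\<lambda>N. 2 ^ m * (2 * pi + 2) / real N) \<longlonglongrightarrow> 0"
      by (rule lim_const_over_n)
  qed
  ultimately have "(\<lambda>N. 1 / 2 * (R N + (2 * of_real (I N) - R N))) \<longlonglongrightarrow> 1 / 2 * (2 * of_real pi * \<i> * L + 0)"
    by (intro tendsto_intros)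
  then have lim: "(\<lambda>N. complex_of_real (I N)) \<longlonglongrightarrow> of_real pi * \<i> * L"
    by (simp add: mult.assoc)
  \<comment> \<open>Monotone convergence is applied to the real function \<open>g\<close>, so the
    real part is taken first. That the limit is itself real follows below, by uniqueness of
    limits.\<close>
  then have "I \<longlonglongrightarrow> Re (of_real pi * \<i> * L)"
    using tendsto_Re by fastforce
  \<comment> \<open>On the positive half-line \<open>g >= 0\<close>, so its truncations to
    \<open>{0<..N}\<close> increase to \<open>g\<close>.\<close>
  then have *: "(g has_integral Re (of_real pi * \<i> * L)) {0<..}"
  proof (rule has_integral_monotone_convergence_increasing[rotated 3])
    fix N :: nat
    have "(g has_integral I N) {0..real N}"
      unfolding I_def by (rule integrable_integral[OF int])
    then have "(g has_integral I N) {0<..real N}"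
      by (subst (asm) has_integral_spike_set_eq[where T = "{0<..real N}"])
         (auto intro: negligible_subset[of "{0}"])
    then show "((\<lambda>x. if x \<in> {0<..real N} then g x else 0) has_integral I N) {0<..}"
      by (subst has_integral_restrict) auto
  next
    fix N :: nat and x :: real
    assume "x \<in> {0<..}"
    then have "g x \<ge> 0" by (simp add: g_def)
    then show "(if x \<in> {0<..real N} then g x else 0) \<le> (if x \<in> {0<..real (Suc N)} then g x else 0)"
      by auto
  next
    fix x :: real assume x: "x \<in> {0<..}"
    have "\<forall>\<^sub>F N in sequentially. x \<le> real N"
      by (rule eventually_compose_filterlim[OF eventually_ge_at_top filterlim_real_sequentially])
    then have "\<forall>\<^sub>F N in sequentially. (if x \<in> {0<..real N} then g x else 0) = g x"
      by eventually_elim (use x in auto)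
    then show "(\<lambda>N. if x \<in> {0<..real N} then g x else 0) \<longlonglongrightarrow> g x"
      by (rule tendsto_eventually)
  qed
  have "(\<lambda>N. complex_of_real (I N)) \<longlonglongrightarrow> of_real (Re (of_real pi * \<i> * L))"
    by (intro tendsto_of_real) fact
  with lim have "of_real pi * \<i> * L = of_real (Re (of_real pi * \<i> * L))"
    by (rule LIMSEQ_unique)
  with has_integral_of_real[OF *] have "((\<lambda>x. complex_of_real (g x)) has_integral (of_real pi * \<i> * L)) {0<..}"
    by metis
  then show ?thesis
    by (rule has_integral_eq[rotated]) (auto simp: g_eq)
qed

section \<open>Assembly of the closed form\<close>

theorem theorem2:
  fixes m n :: nat
  assumes "n \<ge> 2" and "m \<ge> n" and "even m \<longleftrightarrow> even n"
  shows "((\<lambda>z::real. complex_of_real (tanh z ^ m / z ^ n)) has_integral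
           of_nat ((m + m div 2) choose m) *
           (\<Sum>j | 1 \<le> j \<and> j \<le> m \<and> j mod 2 = m mod 2.
              ((- of_nat n :: complex) gchoose (j - 1))
              * ((2 ^ (n + j - 1) - 1) / (of_real pi * \<i>) ^ (n + j - 2))
              * zeta (of_nat (n + j - 1))
              * complex_of_real (S m j)))
         {0<..}"
proof -
  define a :: "nat \<Rightarrow> complex" where
    "a j = fps_coth_pow m $ (m - j) * ((- of_nat n) gchoose (j - 1))" for j
  define Z where "Z s = (2 ^ s - 1) / (of_real pi * \<i>) ^ s * zeta (of_nat s)" for s
  \<comment> \<open>Only finitely many \<open>j\<close> occur, so the series over the poles may be
    summed separately for each \<open>j\<close>. The exponents \<open>n + j - 1\<close> are at least
    2, as convergence requires.\<close>
  have "(\<lambda>k. \<Sum>j=1..m. a j * (1 / tanh_pole k ^ (n + j - 1))) sums (\<Sum>j=1..m. a j * Z (n + j - 1))"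
    unfolding Z_def by (intro sums_sum sums_mult tanh_pole_zeta_sums) (use assms in auto)
  moreover have "residue (\<lambda>z. tanh z ^ m / z ^ n) (tanh_pole k) =
      (\<Sum>j=1..m. a j * (1 / tanh_pole k ^ (n + j - 1)))" for k
    using assms by (subst residue_tanh_power) (auto simp: a_def)
  ultimately have "((\<lambda>z::real. complex_of_real (tanh z ^ m / z ^ n)) has_integral
      (of_real pi * \<i> * (\<Sum>j=1..m. a j * Z (n + j - 1)))) {0<..}"
    by (intro has_integral_tanh_power_over_power assms) simp
  also have "(\<Sum>j=1..m. a j * Z (n + j - 1)) =
      (\<Sum>j | 1 \<le> j \<and> j \<le> m \<and> j mod 2 = m mod 2. a j * Z (n + j - 1))"
  proof (rule sum.mono_neutral_right)
    show "\<forall>j\<in>{1..m} - {j. 1 \<le> j \<and> j \<le> m \<and> j mod 2 = m mod 2}. a j * Z (n + j - 1) = 0"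
    proof
      fix j assume j: "j \<in> {1..m} - {j. 1 \<le> j \<and> j \<le> m \<and> j mod 2 = m mod 2}"
      then have "odd (m - j)" by (auto simp: mod2_eq_if split: if_splits)
      then show "a j * Z (n + j - 1) = 0" by (simp add: a_def fps_coth_pow_nth_odd)
    qed
  qed auto
  also have "of_real pi * \<i> * \<dots> = of_nat ((m + m div 2) choose m) *
           (\<Sum>j | 1 \<le> j \<and> j \<le> m \<and> j mod 2 = m mod 2.
              ((- of_nat n :: complex) gchoose (j - 1))
              * ((2 ^ (n + j - 1) - 1) / (of_real pi * \<i>) ^ (n + j - 2))
              * zeta (of_nat (n + j - 1))
              * complex_of_real (S m j))"
    unfolding sum_distrib_left
  proof (intro sum.cong refl)
    fix j assume j: "j \<in> {j. 1 \<le> j \<and> j \<le> m \<and> j mod 2 = m mod 2}"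
    \<comment> \<open>The factor pi times the imaginary unit, half of that in the residue theorem,
      cancels one power in the denominator. As \<open>n >= 2\<close>, neither subtraction is
      truncated.\<close>
    have "n + j - 1 = Suc (n + j - 2)"
      using assms(1) by simp
    then have "(of_real pi * \<i>) ^ (n + j - 1) = of_real pi * \<i> * (of_real pi * \<i>) ^ (n + j - 2)"
      by (simp only: power_Suc)
    then have "of_real pi * \<i> * Z (n + j - 1) =
        (2 ^ (n + j - 1) - 1) / (of_real pi * \<i>) ^ (n + j - 2) * zeta (of_nat (n + j - 1))"
      unfolding Z_def by simp
    moreover have "a j = of_nat ((m + m div 2) choose m) * of_real (S m j) * ((- of_nat n) gchoose (j - 1))"
      using j by (simp add: a_def fps_coth_pow_nth)
    moreover have "of_real pi * \<i> * (a j * Z (n + j - 1)) = a j * (of_real pi * \<i> * Z (n + j - 1))"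
      by (simp only: ac_simps)
    ultimately show "of_real pi * \<i> * (a j * Z (n + j - 1)) = of_nat ((m + m div 2) choose m) *
             (((- of_nat n :: complex) gchoose (j - 1))
              * ((2 ^ (n + j - 1) - 1) / (of_real pi * \<i>) ^ (n + j - 2))
              * zeta (of_nat (n + j - 1))
              * complex_of_real (S m j))"
      by (simp only: ac_simps)
  qed
  finally show ?thesis .
qed

end
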